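(* Let $\Phi: G\times M\to M$, $(g,m)\mapsto g\cdot m$, be a proper action of a Lie group $G$ on a smooth manifold $M$, let $\overline{M}=M/G$ be the orbit space with orbit map $\pi$, and let $C^{\infty}(\overline{M})=\{\overline f:\overline{M}\to\mathbb{R} \mid \overline f\circ\pi\in C^{\infty}(M)^G\}$. Then $(\overline{M},C^{\infty}(\overline{M}))$ is a differentiable space in the sense of Smith.
   Context: $C^{\infty}(M)^G$ denotes the space of smooth $G$-invariant real valued functions on $M$. $\overline{M}=\{G\cdot m\mid m\in M\}$ carries the quotient topology and $\pi:M\to\overline{M}$ is $m\mapsto G\cdot m$. Let $\mathfrak{R}$ be the collection of all subsets $U$ which are open in $\mathbb{R}^n$ for some $n\in\mathbb{Z}_{\ge0}$. For a topological space $S$, a subset $\mathcal{F}\subseteq C^0(S)$ of the continuous real valued functions on $S$, and $U\in\mathfrak{R}$, let $$\mathcal{F}(U)=\{g\in C^0(U,S)\mid f\circ g\in C^{\infty}(U)\text{ for every }f\in\mathcal{F}\},$$ where $C^0(U,S)$ is the set of continuous maps $U\to S$. $\mathcal{F}$ is a differentiable structure on $S$ (in the sense of Smith) if every $f\in C^0(S)$ such that $f\circ g\in C^{\infty}(U)$ for every $U\in\mathfrak{R}$ and every $g\in\mathcal{F}(U)$ belongs to $\mathcal{F}$. A differentiable space in the sense of Smith is a pair $(S,\mathcal{F})$ with $\mathcal{F}$ a differentiable structure on the topological space $S$. *)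

theory Defs
  imports "HOL-Analysis.Analysis" "HOL-Algebra.Group_Action"
begin

section \<open>Smooth functions on open subsets of Euclidean space\<close>

text \<open>The dimension has to vary inside the formulas below, so \<open>\<real>\<^sup>n\<close> is the library's
  \<^const>\<open>Euclidean_space\<close>: the sequences supported on \<open>{..<n}\<close>, with the product topology.
  Throughout, a function on a topological space is represented by a total function; every notion
  depends only on its values on the \<^const>\<open>topspace\<close> (respectively, on the given open set).\<close>

definition C0 :: "'a topology \<Rightarrow> ('a \<Rightarrow> real) set" where
  "C0 X = {f. continuous_map X euclideanreal f}"

text \<open>\<open>D i x\<close> is the \<open>i\<close>-th partial derivative of \<open>f\<close> at \<open>x\<close>. As \<open>U\<close> is always open in
  \<open>\<real>\<^sup>n\<close>, the values of \<open>f\<close> outside \<open>U\<close> are irrelevant and \<open>D i\<close> is determined on \<open>U\<close>.\<close>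

primrec Ck :: "nat \<Rightarrow> nat \<Rightarrow> (nat \<Rightarrow> real) set \<Rightarrow> ((nat \<Rightarrow> real) \<Rightarrow> real) set" where
  "Ck 0 n U = C0 (subtopology (Euclidean_space n) U)"
| "Ck (Suc k) n U = {f \<in> C0 (subtopology (Euclidean_space n) U).
     \<exists>D. \<forall>i<n. D i \<in> Ck k n U \<and>
       (\<forall>x\<in>U. ((\<lambda>t. f (x(i := t))) has_real_derivative D i x) (at (x i)))}"

definition Cinf :: "nat \<Rightarrow> (nat \<Rightarrow> real) set \<Rightarrow> ((nat \<Rightarrow> real) \<Rightarrow> real) set" where
  "Cinf n U = (\<Inter>k. Ck k n U)"


section \<open>Smooth manifolds\<close>

type_synonym 'a chart = "'a set \<times> ('a \<Rightarrow> nat \<Rightarrow> real)"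

record 'a manifold =
  mtop :: "'a topology"
  mdim :: nat
  atlas :: "'a chart set"

definition is_chart :: "'a topology \<Rightarrow> nat \<Rightarrow> 'a chart \<Rightarrow> bool" where
  "is_chart X n = (\<lambda>(U, \<phi>). openin X U \<and> openin (Euclidean_space n) (\<phi> ` U) \<and>
     homeomorphic_map (subtopology X U) (subtopology (Euclidean_space n) (\<phi> ` U)) \<phi>)"

text \<open>Smoothness of the coordinate expression of \<open>f\<close> in a chart \<open>(U, \<phi>)\<close> of the \<open>n\<close>-dimensional
  source and a chart \<open>(V, \<psi>)\<close> of the \<open>m\<close>-dimensional target.\<close>

definition smooth_in_charts ::
    "nat \<Rightarrow> 'a chart \<Rightarrow> nat \<Rightarrow> 'b chart \<Rightarrow> ('a \<Rightarrow> 'b) \<Rightarrow> bool" where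
  "smooth_in_charts n = (\<lambda>(U, \<phi>) m (V, \<psi>) f.
     \<forall>j<m. (\<lambda>x. \<psi> (f (inv_into U \<phi> x)) j) \<in> Cinf n (\<phi> ` {p \<in> U. f p \<in> V}))"

text \<open>The smooth structure is given by a not necessarily maximal atlas; all notions below
  depend only on the maximal atlas it generates. The transition map from the chart \<open>c\<close> to the
  chart \<open>d\<close> is the coordinate expression of the identity.\<close>

definition smooth_manifold :: "'a manifold \<Rightarrow> bool" where
  "smooth_manifold M \<longleftrightarrow>
     Hausdorff_space (mtop M) \<and> second_countable (mtop M) \<and>
     (\<forall>c\<in>atlas M. is_chart (mtop M) (mdim M) c) \<and>
     (\<Union>c\<in>atlas M. fst c) = topspace (mtop M) \<and>
     (\<forall>c\<in>atlas M. \<forall>d\<in>atlas M. smooth_in_charts (mdim M) c (mdim M) d (\<lambda>p. p))"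

definition smooth_map :: "'a manifold \<Rightarrow> 'b manifold \<Rightarrow> ('a \<Rightarrow> 'b) \<Rightarrow> bool" where
  "smooth_map M N f \<longleftrightarrow> continuous_map (mtop M) (mtop N) f \<and>
     (\<forall>c\<in>atlas M. \<forall>d\<in>atlas N. smooth_in_charts (mdim M) c (mdim N) d f)"

definition smooth_functions :: "'a manifold \<Rightarrow> ('a \<Rightarrow> real) set" where
  "smooth_functions M =
     {f. \<forall>(U, \<phi>)\<in>atlas M. f \<circ> inv_into U \<phi> \<in> Cinf (mdim M) (\<phi> ` U)}"

text \<open>Product charts use the identification of \<open>\<real>\<^sup>n \<times> \<real>\<^sup>m\<close> with \<open>\<real>\<^bsup>n+m\<^esup>\<close> by concatenation.\<close>

definition prod_chart :: "nat \<Rightarrow> 'a chart \<Rightarrow> 'b chart \<Rightarrow> ('a \<times> 'b) chart" where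
  "prod_chart n = (\<lambda>(U, \<phi>) (V, \<psi>).
     (U \<times> V, \<lambda>(x, y) i. if i < n then \<phi> x i else \<psi> y (i - n)))"

definition prod_manifold :: "'a manifold \<Rightarrow> 'b manifold \<Rightarrow> ('a \<times> 'b) manifold" where
  "prod_manifold M N = \<lparr>mtop = prod_topology (mtop M) (mtop N), mdim = mdim M + mdim N,
     atlas = {prod_chart (mdim M) c d | c d. c \<in> atlas M \<and> d \<in> atlas N}\<rparr>"


section \<open>Lie groups and proper actions\<close>

definition lie_group :: "('g, 'r) monoid_scheme \<Rightarrow> 'g manifold \<Rightarrow> bool" where
  "lie_group G L \<longleftrightarrow> group G \<and> smooth_manifold L \<and> topspace (mtop L) = carrier G \<and>
     smooth_map (prod_manifold L L) L (\<lambda>(g, h). g \<otimes>\<^bsub>G\<^esub> h) \<and>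
     smooth_map L L (\<lambda>g. inv\<^bsub>G\<^esub> g)"

text \<open>\<^locale>\<open>group_action\<close> takes values in the bijections of the manifold that are
  \<^const>\<open>undefined\<close> off the manifold; this only normalizes irrelevant values of \<open>\<Phi>\<close>.\<close>

definition smooth_action ::
    "('g, 'r) monoid_scheme \<Rightarrow> 'g manifold \<Rightarrow> 'a manifold \<Rightarrow> ('g \<Rightarrow> 'a \<Rightarrow> 'a) \<Rightarrow> bool" where
  "smooth_action G L M \<Phi> \<longleftrightarrow> group_action G (topspace (mtop M)) \<Phi> \<and>
     smooth_map (prod_manifold L M) M (\<lambda>(g, m). \<Phi> g m)"

definition proper_action ::
    "('g, 'r) monoid_scheme \<Rightarrow> 'g manifold \<Rightarrow> 'a manifold \<Rightarrow> ('g \<Rightarrow> 'a \<Rightarrow> 'a) \<Rightarrow> bool" where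
  "proper_action G L M \<Phi> \<longleftrightarrow> smooth_action G L M \<Phi> \<and>
     proper_map (prod_topology (mtop L) (mtop M)) (prod_topology (mtop M) (mtop M))
       (\<lambda>(g, m). (m, \<Phi> g m))"


section \<open>The orbit space and its smooth functions\<close>

definition orbit_space ::
    "('g, 'r) monoid_scheme \<Rightarrow> 'a topology \<Rightarrow> ('g \<Rightarrow> 'a \<Rightarrow> 'a) \<Rightarrow> 'a set topology" where
  "orbit_space G X \<Phi> = topology (\<lambda>W. W \<subseteq> orbits G (topspace X) \<Phi> \<and>
     openin X {m \<in> topspace X. orbit G \<Phi> m \<in> W})"

lemma openin_orbit_space:
  "openin (orbit_space G X \<Phi>) W \<longleftrightarrow>
     W \<subseteq> orbits G (topspace X) \<Phi> \<and> openin X {m \<in> topspace X. orbit G \<Phi> m \<in> W}"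
proof -
  let ?P = "\<lambda>W. W \<subseteq> orbits G (topspace X) \<Phi> \<and> openin X {m \<in> topspace X. orbit G \<Phi> m \<in> W}"
  have "istopology ?P"
    unfolding istopology_def
  proof (intro conjI allI impI)
    fix S T assume S: "?P S" and T: "?P T"
    show "S \<inter> T \<subseteq> orbits G (topspace X) \<Phi>" using S by blast
    have "openin X ({m \<in> topspace X. orbit G \<Phi> m \<in> S} \<inter> {m \<in> topspace X. orbit G \<Phi> m \<in> T})"
      by (intro openin_Int conjunct2[OF S] conjunct2[OF T])
    also have "{m \<in> topspace X. orbit G \<Phi> m \<in> S} \<inter> {m \<in> topspace X. orbit G \<Phi> m \<in> T} =
        {m \<in> topspace X. orbit G \<Phi> m \<in> S \<inter> T}" by blast
    finally show "openin X {m \<in> topspace X. orbit G \<Phi> m \<in> S \<inter> T}" .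
  next
    fix \<K> assume K: "\<forall>K\<in>\<K>. ?P K"
    then show "\<Union>\<K> \<subseteq> orbits G (topspace X) \<Phi>" by blast
    have "openin X (\<Union>K\<in>\<K>. {m \<in> topspace X. orbit G \<Phi> m \<in> K})"
      using K by (intro openin_Union) fast
    also have "(\<Union>K\<in>\<K>. {m \<in> topspace X. orbit G \<Phi> m \<in> K}) =
        {m \<in> topspace X. orbit G \<Phi> m \<in> \<Union>\<K>}" by blast
    finally show "openin X {m \<in> topspace X. orbit G \<Phi> m \<in> \<Union>\<K>}" .
  qed
  then show ?thesis
    by (simp add: orbit_space_def topology_inverse')
qed

lemma topspace_orbit_space: "topspace (orbit_space G X \<Phi>) = orbits G (topspace X) \<Phi>"
proof -
  have "{m \<in> topspace X. orbit G \<Phi> m \<in> orbits G (topspace X) \<Phi>} = topspace X"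
    by (auto simp: orbits_def)
  then have "openin (orbit_space G X \<Phi>) (orbits G (topspace X) \<Phi>)"
    by (simp add: openin_orbit_space)
  then show ?thesis
    by (meson openin_orbit_space openin_subset openin_topspace subset_antisym)
qed

lemma quotient_map_orbit: "quotient_map X (orbit_space G X \<Phi>) (orbit G \<Phi>)"
  unfolding quotient_map_def topspace_orbit_space
  by (auto simp: openin_orbit_space orbits_def)

definition invariant_smooth_functions ::
    "('g, 'r) monoid_scheme \<Rightarrow> 'a manifold \<Rightarrow> ('g \<Rightarrow> 'a \<Rightarrow> 'a) \<Rightarrow> ('a \<Rightarrow> real) set" where
  "invariant_smooth_functions G M \<Phi> = {f \<in> smooth_functions M.
     \<forall>g\<in>carrier G. \<forall>m\<in>topspace (mtop M). f (\<Phi> g m) = f m}"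

definition orbit_space_functions ::
    "('g, 'r) monoid_scheme \<Rightarrow> 'a manifold \<Rightarrow> ('g \<Rightarrow> 'a \<Rightarrow> 'a) \<Rightarrow> ('a set \<Rightarrow> real) set" where
  "orbit_space_functions G M \<Phi> = {f. f \<circ> orbit G \<Phi> \<in> invariant_smooth_functions G M \<Phi>}"


section \<open>Differentiable spaces in the sense of Smith\<close>

text \<open>\<open>plots S F n U\<close> is \<open>\<F>(U)\<close>, where \<open>U\<close> is regarded as an open subset of \<open>\<real>\<^sup>n\<close>.\<close>

definition plots :: "'a topology \<Rightarrow> ('a \<Rightarrow> real) set \<Rightarrow> nat \<Rightarrow> (nat \<Rightarrow> real) set \<Rightarrow>
    ((nat \<Rightarrow> real) \<Rightarrow> 'a) set" where
  "plots S F n U = {g. continuous_map (subtopology (Euclidean_space n) U) S g \<and>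
     (\<forall>f\<in>F. f \<circ> g \<in> Cinf n U)}"

definition differentiable_structure :: "'a topology \<Rightarrow> ('a \<Rightarrow> real) set \<Rightarrow> bool" where
  "differentiable_structure S F \<longleftrightarrow> F \<subseteq> C0 S \<and>
     (\<forall>f\<in>C0 S.
        (\<forall>n U. openin (Euclidean_space n) U \<longrightarrow> (\<forall>g\<in>plots S F n U. f \<circ> g \<in> Cinf n U))
        \<longrightarrow> f \<in> F)"

definition smith_differentiable_space :: "'a topology \<times> ('a \<Rightarrow> real) set \<Rightarrow> bool" where
  "smith_differentiable_space = (\<lambda>(S, F). differentiable_structure S F)"

end

theory Submission
  imports Defs
begin

text \<open>Let \<open>\<pi>\<close> be the orbit map. Whether a function on the manifold is smooth is decided on the
  inverses of the charts, and composing such an inverse with \<open>\<pi>\<close> gives a plot of the orbit space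
  (\<open>orbit_chart_plot\<close>), because the functions of the orbit space were defined by pulling back
  along \<open>\<pi>\<close>. So if \<open>f\<close> is smooth along all plots, then \<open>f \<circ> \<pi>\<close> is smooth in all charts; it is
  invariant because \<open>\<pi>\<close> is (\<open>orbit_translate\<close>), and hence \<open>f\<close> belongs to the structure. The
  structure consists of continuous functions since smooth functions on a manifold are continuous
  (\<open>smooth_functions_continuous\<close>) and continuity descends along the quotient map \<open>\<pi>\<close>.\<close>

lemma chart_inverse_continuous:
  assumes "is_chart X n (U, \<phi>)"
  shows "continuous_map (subtopology (Euclidean_space n) (\<phi> ` U)) X (inv_into U \<phi>)"
proof -
  have U: "U \<subseteq> topspace X"
    and img: "topspace (subtopology (Euclidean_space n) (\<phi> ` U)) = \<phi> ` U"
    and hom: "homeomorphic_map (subtopology X U) (subtopology (Euclidean_space n) (\<phi> ` U)) \<phi>"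
    using assms openin_subset by (auto simp: is_chart_def)
  then have inj: "inj_on \<phi> U"
    by (metis homeomorphic_imp_injective_map topspace_subtopology_subset)
  obtain \<psi> where "homeomorphic_maps (subtopology X U)
      (subtopology (Euclidean_space n) (\<phi> ` U)) \<phi> \<psi>"
    using hom homeomorphic_map_maps by blast
  then have \<psi>: "continuous_map (subtopology (Euclidean_space n) (\<phi> ` U)) (subtopology X U) \<psi>"
    and eq: "\<forall>p\<in>U. \<psi> (\<phi> p) = p"
    using U by (auto simp: homeomorphic_maps_def)
  have "continuous_map (subtopology (Euclidean_space n) (\<phi> ` U)) X \<psi>"
    using \<psi> by (rule continuous_map_into_fulltopology)
  then show ?thesis
    by (rule continuous_map_eq) (use eq inj img in auto)
qed

text \<open>Smoothness is a condition on the coordinate expressions alone, so continuity has to be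
  transported back along each chart and glued over the open cover by chart domains.\<close>

lemma smooth_functions_continuous:
  assumes M: "smooth_manifold M" and f: "f \<in> smooth_functions M"
  shows "f \<in> C0 (mtop M)"
proof -
  have "continuous_map (mtop M) euclideanreal f"
  proof (rule pasting_lemma[where I = "atlas M" and T = fst and f = "\<lambda>_. f"])
    fix c assume c: "c \<in> atlas M"
    obtain U \<phi> where [simp]: "c = (U, \<phi>)" by fastforce
    have chart: "is_chart (mtop M) (mdim M) (U, \<phi>)"
      using M c by (auto simp: smooth_manifold_def)
    then show "openin (mtop M) (fst c)"
      by (simp add: is_chart_def)
    then have U: "topspace (subtopology (mtop M) U) = U"
      using openin_subset by auto
    have hom: "homeomorphic_map (subtopology (mtop M) U)
        (subtopology (Euclidean_space (mdim M)) (\<phi> ` U)) \<phi>"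
      using chart by (simp add: is_chart_def)
    have "f \<circ> inv_into U \<phi> \<in> Cinf (mdim M) (\<phi> ` U)"
      using f c by (auto simp: smooth_functions_def)
    then have "f \<circ> inv_into U \<phi> \<in> Ck 0 (mdim M) (\<phi> ` U)"
      unfolding Cinf_def by blast
    then have "continuous_map (subtopology (Euclidean_space (mdim M)) (\<phi> ` U)) euclideanreal
        (f \<circ> inv_into U \<phi>)"
      by (simp add: C0_def)
    with homeomorphic_imp_continuous_map[OF hom]
    have "continuous_map (subtopology (mtop M) U) euclideanreal (f \<circ> inv_into U \<phi> \<circ> \<phi>)"
      by (rule continuous_map_compose)
    then have "continuous_map (subtopology (mtop M) U) euclideanreal f"
      by (rule continuous_map_eq)
        (use homeomorphic_imp_injective_map[OF hom] U in \<open>metis comp_def inv_into_f_f\<close>)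
    then show "continuous_map (subtopology (mtop M) (fst c)) euclideanreal f" by simp
  next
    fix x assume "x \<in> topspace (mtop M)"
    then have "x \<in> (\<Union>c\<in>atlas M. fst c)"
      using M by (simp add: smooth_manifold_def)
    then show "\<exists>c. c \<in> atlas M \<and> x \<in> fst c \<and> f x = f x" by blast
  qed (rule refl)
  then show ?thesis by (simp add: C0_def)
qed

lemma (in group_action) orbit_translate:
  assumes g: "g \<in> carrier G" and x: "x \<in> E"
  shows "orbit G \<phi> (\<phi> g x) = orbit G \<phi> x"
proof -
  have gx: "\<phi> g x \<in> E"
    using g x element_image by blast
  have "\<phi> g x \<in> orbit G \<phi> x"
    using g by (auto simp: orbit_def)
  moreover from this have "x \<in> orbit G \<phi> (\<phi> g x)"
    using gx x orbit_sym by blast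
  moreover have "orbit G \<phi> z \<subseteq> orbit G \<phi> y" if "y \<in> E" "z \<in> E" "z \<in> orbit G \<phi> y" for y z
  proof
    fix w assume w: "w \<in> orbit G \<phi> z"
    then have "w \<in> E"
      using that(2) element_image by (auto simp: orbit_def)
    then show "w \<in> orbit G \<phi> y"
      using orbit_trans that w by blast
  qed
  ultimately show ?thesis
    using gx x by (intro subset_antisym) simp_all
qed

text \<open>For \<open>f\<close> in the structure, the composite of \<open>f\<close> with this map is the coordinate expression of
  the smooth function \<open>f \<circ> orbit G \<Phi>\<close>. These plots are enough to detect smoothness on the orbit
  space.\<close>

lemma orbit_chart_plot:
  assumes M: "smooth_manifold M" and c: "(U, \<phi>) \<in> atlas M"
  shows "orbit G \<Phi> \<circ> inv_into U \<phi> \<in>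
    plots (orbit_space G (mtop M) \<Phi>) (orbit_space_functions G M \<Phi>) (mdim M) (\<phi> ` U)"
proof -
  have "continuous_map (subtopology (Euclidean_space (mdim M)) (\<phi> ` U)) (mtop M) (inv_into U \<phi>)"
    using M c by (intro chart_inverse_continuous) (auto simp: smooth_manifold_def)
  then have "continuous_map (subtopology (Euclidean_space (mdim M)) (\<phi> ` U))
      (orbit_space G (mtop M) \<Phi>) (orbit G \<Phi> \<circ> inv_into U \<phi>)"
    by (rule continuous_map_compose) (rule quotient_imp_continuous_map[OF quotient_map_orbit])
  moreover have "f \<circ> (orbit G \<Phi> \<circ> inv_into U \<phi>) \<in> Cinf (mdim M) (\<phi> ` U)"
    if "f \<in> orbit_space_functions G M \<Phi>" for f
  proof -
    have "f \<circ> orbit G \<Phi> \<in> smooth_functions M"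
      using that by (simp add: orbit_space_functions_def invariant_smooth_functions_def)
    then show ?thesis
      using c by (auto simp: smooth_functions_def o_assoc)
  qed
  ultimately show ?thesis by (simp add: plots_def)
qed

theorem theorem6p2p2:
  fixes G :: "('g, 'r) monoid_scheme"
    and L :: "'g manifold"
    and M :: "'a manifold"
    and \<Phi> :: "'g \<Rightarrow> 'a \<Rightarrow> 'a"
  assumes "lie_group G L"
    and "smooth_manifold M"
    and "proper_action G L M \<Phi>"
  shows "smith_differentiable_space
    (orbit_space G (mtop M) \<Phi>, orbit_space_functions G M \<Phi>)"
proof -
  let ?S = "orbit_space G (mtop M) \<Phi>" and ?F = "orbit_space_functions G M \<Phi>"
  interpret group_action G "topspace (mtop M)" \<Phi>
    using assms(3) by (simp add: proper_action_def smooth_action_def)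
  have "f \<in> C0 ?S" if "f \<in> ?F" for f
  proof -
    have "continuous_map (mtop M) euclideanreal (f \<circ> orbit G \<Phi>)"
      using that smooth_functions_continuous[OF assms(2)]
      by (auto simp: orbit_space_functions_def invariant_smooth_functions_def C0_def)
    then show ?thesis
      by (simp add: C0_def continuous_compose_quotient_map_eq[OF quotient_map_orbit])
  qed
  moreover have "f \<in> ?F"
    if smooth: "\<forall>n U. openin (Euclidean_space n) U \<longrightarrow>
      (\<forall>g\<in>plots ?S ?F n U. f \<circ> g \<in> Cinf n U)" for f
  proof -
    have "f \<circ> orbit G \<Phi> \<in> smooth_functions M"
      unfolding smooth_functions_def
    proof clarify
      fix U \<phi> assume c: "(U, \<phi>) \<in> atlas M"
      then have "openin (Euclidean_space (mdim M)) (\<phi> ` U)"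
        using assms(2) by (auto simp: smooth_manifold_def is_chart_def)
      then have "f \<circ> (orbit G \<Phi> \<circ> inv_into U \<phi>) \<in> Cinf (mdim M) (\<phi> ` U)"
        using smooth orbit_chart_plot[OF assms(2) c] by blast
      then show "f \<circ> orbit G \<Phi> \<circ> inv_into U \<phi> \<in> Cinf (mdim M) (\<phi> ` U)"
        by (simp add: o_assoc)
    qed
    then show ?thesis
      by (simp add: orbit_space_functions_def invariant_smooth_functions_def orbit_translate)
  qed
  ultimately show ?thesis
    unfolding smith_differentiable_space_def differentiable_structure_def by blast
qed

end
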